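(* Let $E, F\subset \mathbb{R}^2$ be connected sets, each with cardinality greater than $1$. If $F$ is compact and not a line segment, then the arithmetic sum $E+F$ has non-empty interior.
   Context: For $E,F\subset\mathbb{R}^2$, the arithmetic sum is $E+F=\{x+y : x\in E,\ y\in F\}$. Interior is taken in $\mathbb{R}^2$ with its usual topology. A (compact) line segment is a set of the form $\{(1-t)p+tq : t\in[0,1]\}$ with $p\neq q$ in $\mathbb{R}^2$. *)

theory Defs
  imports "HOL-Analysis.Analysis"
begin

end

theory Submission
  imports Defs "HOL-Complex_Analysis.Winding_Numbers"
begin

text \<open>
  A point \<open>x\<close> lies outside \<open>E + F\<close> exactly when \<open>x - F\<close> misses \<open>E\<close>. If \<open>E + F\<close> had empty
  interior, such points \<open>x\<close> would be dense, and out of pieces of the sets \<open>x - F\<close> one could build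
  a barrier that separates two points \<open>p\<close> and \<open>q\<close> of the connected set \<open>E\<close> without meeting
  \<open>E\<close>, which is absurd. The proof constructs this barrier as a chain of beads around \<open>p\<close>.

  The beads are made from two subcontinua \<open>A\<close> and \<open>B\<close> of \<open>F\<close>, small compared with the distance of
  \<open>p\<close> and \<open>q\<close>. As \<open>x\<close> and \<open>y\<close> can be chosen only from a dense set, the translates \<open>x - A\<close>
  and \<open>y - B\<close> have to meet in a way that is stable under perturbation, so \<open>A - B\<close> must have
  interior points (\<open>interior_sum_of_linked_continua\<close>). The barrier property itself is a winding number
  argument (\<open>necklace_meets_connected\<close>).

  The difference set \<open>A - B\<close> has interior points as soon as \<open>A\<close> and \<open>B\<close> have chords \<open>u\<close> and \<open>v\<close>
  that are not parallel (\<open>interior_sum_of_continua\<close>): the translates of \<open>A - B\<close> by the lattice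
  spanned by \<open>u\<close> and \<open>v\<close> cover the plane, because a sum of two paths with these chords, extended
  periodically, is a bounded perturbation of a linear isomorphism.

  Finally, a continuum that is not a segment has arbitrarily small subcontinua with non-parallel chords
  (\<open>nonparallel_small_subcontinua\<close>). Otherwise it would be made up of short parallel segments, and
  its connectedness would force it into a single line.

  The plane is identified with the complex numbers so that winding numbers apply.
\<close>

section \<open>Paths along connected sets\<close>

text \<open>Each path is followed during one unit of time. This gives both the periodic extension of a path
  and a loop that runs through a cyclic chain of sets.\<close>

lemma continuous_on_concatenated_paths:
  fixes p :: "int \<Rightarrow> real \<Rightarrow> 'a::topological_space"
  assumes "\<And>i. path (p i)" and "\<And>i. pathfinish (p i) = pathstart (p (i + 1))"
  shows "continuous_on UNIV (\<lambda>t. p \<lfloor>t\<rfloor> (frac t))"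
proof -
  let ?G = "\<lambda>t. p \<lfloor>t\<rfloor> (frac t)"
  have G: "?G t = p i (t - of_int i)" if "t \<in> {of_int i..of_int i + 1}" for i t
  proof (cases "t = of_int i + 1")
    case True
    then have "\<lfloor>t\<rfloor> = i + 1" "frac t = 0"
      by (auto simp: frac_def)
    then show ?thesis
      using assms(2)[of i] True by (simp add: pathfinish_def pathstart_def)
  next
    case False
    then have "\<lfloor>t\<rfloor> = i"
      using that by (intro floor_unique) auto
    then show ?thesis
      by (simp add: frac_def)
  qed
  have cont: "continuous_on {of_int i..of_int i + 1} ?G" for i :: int
  proof -
    have "continuous_on {of_int i..of_int i + 1} (\<lambda>t. p i (t - of_int i))"
      by (rule continuous_on_compose2[OF assms(1)[of i, unfolded path_def]])
         (auto intro!: continuous_intros)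
    then show ?thesis
      using G by (subst continuous_on_cong[OF refl]) auto
  qed
  \<comment> \<open>The two closed unit intervals around \<open>\<lfloor>t\<rfloor>\<close> cover a neighbourhood of \<open>t\<close>,
      also when \<open>t\<close> is an integer.\<close>
  have "isCont ?G t" for t
  proof -
    let ?i = "\<lfloor>t\<rfloor>"
    have "continuous_on ({of_int (?i - 1)..of_int (?i - 1) + 1} \<union> {of_int ?i..of_int ?i + 1}) ?G"
      by (intro continuous_on_closed_Un cont) auto
    then have "continuous_on {of_int ?i - 1<..<of_int ?i + 1} ?G"
      by (rule continuous_on_subset) auto
    moreover have "t \<in> {of_int ?i - 1<..<of_int ?i + 1}"
      by (auto, linarith+)
    ultimately show ?thesis
      by (metis continuous_on_eq_continuous_at open_greaterThanLessThan)
  qed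
  then show ?thesis
    by (simp add: continuous_at_imp_continuous_on)
qed

text \<open>A connected set need not contain a path between two of its points, but its open
  \<open>\<epsilon>\<close>-neighbourhood is open and connected, hence path connected.\<close>

lemma path_near_connected_set:
  fixes A :: "'a::euclidean_space set"
  assumes "connected A" "a \<in> A" "b \<in> A" "0 < \<epsilon>"
  obtains g where "path g" "pathstart g = a" "pathfinish g = b"
    "\<And>t. t \<in> {0..1} \<Longrightarrow> \<exists>x\<in>A. dist x (g t) < \<epsilon>"
proof -
  let ?U = "\<Union>x\<in>A. ball x \<epsilon>"
  have "?U = (\<lambda>(x, y). x + y) ` (A \<times> ball 0 \<epsilon>)"
  proof (intro set_eqI iffI)
    fix z assume "z \<in> ?U"
    then obtain x where "x \<in> A" "dist x z < \<epsilon>" by auto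
    then show "z \<in> (\<lambda>(x, y). x + y) ` (A \<times> ball 0 \<epsilon>)"
      by (intro image_eqI[of _ _ "(x, z - x)"]) (auto simp: dist_norm norm_minus_commute)
  next
    fix z assume "z \<in> (\<lambda>(x, y). x + y) ` (A \<times> ball 0 \<epsilon>)"
    then obtain x y where "z = x + y" "x \<in> A" "norm y < \<epsilon>" by auto
    then show "z \<in> ?U"
      by (intro UN_I[of x]) (auto simp: dist_norm)
  qed
  moreover have "connected ((\<lambda>(x, y). x + y) ` (A \<times> ball 0 \<epsilon>))"
    using assms(1)
    by (intro connected_continuous_image connected_Times connected_ball)
       (auto simp: split_beta intro!: continuous_intros)
  ultimately have "connected ?U"
    by simp
  then have "path_connected ?U"
    by (intro connected_open_path_connected) auto
  moreover have "a \<in> ?U" "b \<in> ?U"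
    using assms by (meson UN_I centre_in_ball)+
  ultimately obtain g where g: "path g" "path_image g \<subseteq> ?U" "pathstart g = a" "pathfinish g = b"
    unfolding path_connected_def by meson
  have "\<exists>x\<in>A. dist x (g t) < \<epsilon>" if "t \<in> {0..1}" for t
  proof -
    have "g t \<in> ?U"
      using that g(2) unfolding path_image_def by blast
    then show ?thesis
      by simp
  qed
  with g show thesis
    by (intro that)
qed

section \<open>Sums of two continua with non-parallel chords\<close>

lemma interior_finite_Union_closed:
  assumes "finite I" "\<And>i. i \<in> I \<Longrightarrow> closed (S i)" "interior (\<Union>i\<in>I. S i) \<noteq> {}"
  shows "\<exists>i\<in>I. interior (S i) \<noteq> {}"
  using assms
proof (induction I rule: finite_induct)
  case (insert i I)
  show ?case
  proof (cases "interior (\<Union>i\<in>I. S i) = {}")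
    case True
    then show ?thesis
      using interior_closed_Un_empty_interior[of "S i" "\<Union>i\<in>I. S i"] insert by auto
  qed (use insert in auto)
qed auto

text \<open>The determinant of two plane vectors; it vanishes exactly when they are parallel.\<close>

definition cross :: "complex \<Rightarrow> complex \<Rightarrow> real" where
  "cross a b = Im (cnj a * b)"

lemma cross_diff_right: "cross a (b - c) = cross a b - cross a c"
  by (simp add: cross_def algebra_simps)

lemma cross_basis_expansion:
  assumes "cross u v \<noteq> 0"
  shows "z = of_real (cross z v / cross u v) * u + of_real (cross u z / cross u v) * v"
proof -
  have "of_real (cross u v) * z = of_real (cross z v) * u + of_real (cross u z) * v"
    by (simp add: complex_eq_iff cross_def algebra_simps)
  then show ?thesis
    using assms by (simp add: field_simps)
qed

text \<open>Let \<open>u\<close> and \<open>v\<close> be the chords of \<open>f\<close> and \<open>g\<close>. Extended by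
  \<open>f (s + 1) = f s + u\<close>, the path \<open>f\<close> stays at bounded distance from the line
  \<open>s \<mapsto> s u\<close>, and likewise for \<open>g\<close>. So \<open>(s, t) \<mapsto> f s + g t\<close> is a bounded continuous
  perturbation of the linear isomorphism \<open>(s, t) \<mapsto> s u + t v\<close>, and by Brouwer's theorem such a
  map is onto. In other words, the sum of the two paths covers the torus that is the
  quotient of the plane by the lattice spanned by \<open>u\<close> and \<open>v\<close>.\<close>

lemma lattice_translates_of_path_sum_cover:
  fixes f g :: "real \<Rightarrow> complex"
  assumes f: "path f" and g: "path g"
    and uv: "cross (pathfinish f - pathstart f) (pathfinish g - pathstart g) \<noteq> 0"
  obtains s t and m n :: int where "s \<in> {0..1}" "t \<in> {0..1}"
    "z = f s + g t + of_int m * (pathfinish f - pathstart f) + of_int n * (pathfinish g - pathstart g)"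
proof -
  define u v where "u = pathfinish f - pathstart f" and "v = pathfinish g - pathstart g"
  \<comment> \<open>The periodic difference between the extended path and its linear part.\<close>
  define per :: "(real \<Rightarrow> complex) \<Rightarrow> real \<Rightarrow> complex"
    where "per h s = h (frac s) - of_real (frac s) * (pathfinish h - pathstart h)" for h s
  have per: "continuous_on UNIV (per h) \<and> (\<exists>M. \<forall>s. norm (per h s) \<le> M)" if h: "path h" for h
  proof -
    define q where "q s = h s - of_real s * (pathfinish h - pathstart h)" for s
    have q: "path q" "pathfinish q = pathstart q"
      using h unfolding path_def q_def pathfinish_def pathstart_def
      by (auto intro!: continuous_intros)
    have "continuous_on UNIV (\<lambda>s. (\<lambda>i::int. q) \<lfloor>s\<rfloor> (frac s))"
      using q by (intro continuous_on_concatenated_paths) auto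
    then have "continuous_on UNIV (per h)"
      by (simp add: per_def[abs_def] q_def)
    moreover obtain M where M: "\<And>w. w \<in> path_image q \<Longrightarrow> norm w \<le> M"
      using bounded_path_image[OF q(1)] bounded_iff by blast
    have "norm (per h s) \<le> M" for s
      using M[of "q (frac s)"] by (auto simp: path_image_def per_def q_def frac_lt_1 less_imp_le)
    ultimately show ?thesis by blast
  qed
  obtain M N where M: "\<And>s. norm (per f s) \<le> M" and N: "\<And>s. norm (per g s) \<le> N"
    using per[OF f] per[OF g] by blast
  define S T where "S w = cross w v / cross u v" and "T w = cross u w / cross u v" for w
  have contST: "continuous_on X S" "continuous_on X T" for X
    unfolding S_def T_def cross_def by (intro continuous_intros; use uv u_def v_def cross_def in simp)+
  define R where "R = norm z + M + N + 1"
  \<comment> \<open>In the coordinates \<open>S, T\<close> of the basis \<open>u, v\<close>, a fixed point of \<open>\<phi>\<close> is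
      a solution of \<open>f (S w) + g (T w) = z\<close> for the extended paths.\<close>
  define \<phi> where "\<phi> w = z - per f (S w) - per g (T w)" for w
  have "0 \<le> M" "0 \<le> N"
    using M N norm_ge_zero order_trans by blast+
  then have "R > 0"
    unfolding R_def by (smt (verit) norm_ge_zero)
  moreover have "continuous_on (cball 0 R) \<phi>"
    unfolding \<phi>_def
    by (intro continuous_intros continuous_on_compose2[OF per[OF f, THEN conjunct1]]
        continuous_on_compose2[OF per[OF g, THEN conjunct1]] contST) auto
  moreover have "\<phi> \<in> cball 0 R \<rightarrow> cball 0 R"
  proof
    fix w
    have "norm (\<phi> w) \<le> norm z + norm (per f (S w)) + norm (per g (T w))"
      unfolding \<phi>_def by (meson norm_triangle_ineq4 order_trans add_mono order_refl)
    then show "\<phi> w \<in> cball 0 R"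
      using M[of "S w"] N[of "T w"] by (simp add: R_def)
  qed
  ultimately obtain w where w: "\<phi> w = w"
    using brouwer_ball by blast
  have exp: "w = of_real (S w) * u + of_real (T w) * v"
    unfolding S_def T_def using uv by (intro cross_basis_expansion) (simp add: u_def v_def)
  have "z = per f (S w) + per g (T w) + w"
    using w by (simp add: \<phi>_def algebra_simps)
  also have "\<dots> = per f (S w) + per g (T w) + (of_real (S w) * u + of_real (T w) * v)"
    using exp by simp
  also have "\<dots> = f (frac (S w)) + g (frac (T w)) + of_int \<lfloor>S w\<rfloor> * u + of_int \<lfloor>T w\<rfloor> * v"
    by (simp add: per_def frac_def u_def v_def algebra_simps)
  finally show thesis
    by (intro that[of "frac (S w)" "frac (T w)" "\<lfloor>S w\<rfloor>" "\<lfloor>T w\<rfloor>"])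
       (auto simp: u_def v_def frac_lt_1 less_imp_le)
qed

text \<open>Paths that run ever closer to \<open>A\<close> and \<open>B\<close> between the chosen endpoints always have the
  same chords, so by compactness the translates of the sum by the lattice of these chords cover the
  plane. Only finitely many of these compact translates meet the unit disc, hence one of them has
  interior points.\<close>

lemma interior_sum_of_continua:
  fixes A B :: "complex set"
  assumes A: "compact A" "connected A" "a \<in> A" "a' \<in> A"
    and B: "compact B" "connected B" "b \<in> B" "b' \<in> B"
    and ab: "cross (a' - a) (b' - b) \<noteq> 0"
  shows "interior {x + y | x y. x \<in> A \<and> y \<in> B} \<noteq> {}"
proof -
  define u v where "u = a' - a" and "v = b' - b"
  have uv: "cross u v \<noteq> 0"
    using ab by (simp add: u_def v_def)
  define P where "P = {x + y | x y. x \<in> A \<and> y \<in> B}"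
  have "compact P"
    unfolding P_def by (rule compact_sums[OF A(1) B(1)])
  then obtain M where M: "\<And>w. w \<in> P \<Longrightarrow> norm w \<le> M"
    by (meson compact_imp_bounded bounded_iff)
  define L where "L k = of_int (fst k) * u + of_int (snd k) * v" for k :: "int \<times> int"
  \<comment> \<open>\<open>W\<close> contains the index of each lattice vector that moves a point of \<open>P\<close> 
      to within distance 2 of the unit disc.\<close>
  define W where "W = {k. norm (L k) \<le> M + 3}"
  have coord: "of_int (fst k) = cross (L k) v / cross u v" "of_int (snd k) = cross u (L k) / cross u v" for k
    using uv by (simp_all add: L_def cross_def field_simps)
  have finW: "finite W"
  proof (rule finite_subset)
    define c where "c = (norm u + norm v) * (M + 3) / \<bar>cross u v\<bar>"
    have cr: "\<bar>cross x y\<bar> \<le> norm x * norm y" for x y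
      unfolding cross_def by (metis abs_Im_le_cmod complex_mod_cnj norm_mult)
    have bd: "\<bar>of_int (fst k)\<bar> \<le> c" "\<bar>of_int (snd k)\<bar> \<le> c" if "k \<in> W" for k
    proof -
      have Lk: "norm (L k) \<le> M + 3" using that by (simp add: W_def)
      have "0 \<le> M + 3" using Lk norm_ge_zero order_trans by blast
      have "\<bar>cross (L k) v\<bar> \<le> (M + 3) * norm v"
        using cr[of "L k" v] Lk by (meson mult_right_mono norm_ge_zero order_trans)
      also have "\<dots> \<le> (norm u + norm v) * (M + 3)"
        using mult_nonneg_nonneg[OF norm_ge_zero[of u] \<open>0 \<le> M + 3\<close>] by (simp add: algebra_simps)
      finally show "\<bar>of_int (fst k)\<bar> \<le> c"
        by (simp only: coord c_def abs_divide) (simp add: divide_right_mono)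
      have "\<bar>cross u (L k)\<bar> \<le> norm u * (M + 3)"
        using cr[of u "L k"] Lk by (meson mult_left_mono norm_ge_zero order_trans)
      also have "\<dots> \<le> (norm u + norm v) * (M + 3)"
        using mult_nonneg_nonneg[OF norm_ge_zero[of v] \<open>0 \<le> M + 3\<close>] by (simp add: algebra_simps)
      finally show "\<bar>of_int (snd k)\<bar> \<le> c"
        by (simp only: coord c_def abs_divide) (simp add: divide_right_mono)
    qed
    show "W \<subseteq> {\<lfloor>-c\<rfloor>..\<lceil>c\<rceil>} \<times> {\<lfloor>-c\<rfloor>..\<lceil>c\<rceil>}"
    proof
      fix k assume "k \<in> W"
      then show "k \<in> {\<lfloor>-c\<rfloor>..\<lceil>c\<rceil>} \<times> {\<lfloor>-c\<rfloor>..\<lceil>c\<rceil>}"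
        using bd[of k] by (cases k) (auto simp: abs_le_iff; linarith)
    qed
  qed auto
  define Q where "Q = (\<Union>k\<in>W. (+) (L k) ` P)"
  have cl: "closed ((+) (L k) ` P)" for k
    using \<open>compact P\<close> by (simp add: compact_imp_closed closed_translation)
  have "closed Q"
    unfolding Q_def using finW cl by blast
  have "z \<in> Q" if z: "norm z < 1" for z
  proof -
    have "\<exists>q\<in>Q. dist q z < \<epsilon>" if "\<epsilon> > 0" for \<epsilon>
    proof -
      define \<delta> where "\<delta> = min (\<epsilon> / 2) 1"
      have \<delta>: "0 < \<delta>" using that by (simp add: \<delta>_def)
      obtain f where f: "path f" "pathstart f = a" "pathfinish f = a'"
          "\<And>t. t \<in> {0..1} \<Longrightarrow> \<exists>x\<in>A. dist x (f t) < \<delta>"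
        using path_near_connected_set[OF A(2-4) \<delta>] by blast
      obtain g where g: "path g" "pathstart g = b" "pathfinish g = b'"
          "\<And>t. t \<in> {0..1} \<Longrightarrow> \<exists>x\<in>B. dist x (g t) < \<delta>"
        using path_near_connected_set[OF B(2-4) \<delta>] by blast
      obtain s t and m n :: int where st: "s \<in> {0..1}" "t \<in> {0..1}"
          and zst: "z = f s + g t + of_int m * u + of_int n * v"
        using lattice_translates_of_path_sum_cover[OF f(1) g(1), of z, unfolded f(2,3) g(2,3),
            folded u_def v_def, OF uv] by blast
      obtain x y where x: "x \<in> A" "dist x (f s) < \<delta>" and y: "y \<in> B" "dist y (g t) < \<delta>"
        using f(4) g(4) st by meson
      have "x + y \<in> P" using x y by (auto simp: P_def)
      define q where "q = L (m, n) + (x + y)"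
      have "dist q z = norm ((x - f s) + (y - g t))"
        by (simp add: q_def L_def zst dist_norm algebra_simps)
      also have "\<dots> < \<delta> + \<delta>"
        using x(2) y(2) norm_triangle_ineq[of "x - f s" "y - g t"] by (simp add: dist_norm)
      finally have qz: "dist q z < \<delta> + \<delta>" .
      then have "norm q < 3"
        using z norm_triangle_ineq2[of q z] by (simp add: dist_norm \<delta>_def)
      moreover have "norm (L (m, n)) \<le> norm q + norm (x + y)"
        unfolding q_def by (metis add_diff_cancel_right' norm_triangle_ineq4)
      ultimately have "(m, n) \<in> W"
        using M[OF \<open>x + y \<in> P\<close>] by (simp add: W_def)
      then have "q \<in> Q"
        unfolding Q_def q_def using \<open>x + y \<in> P\<close> by blast
      with qz show ?thesis
        by (intro bexI[of _ q]) (auto simp: \<delta>_def)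
    qed
    then have "z \<in> closure Q"
      by (simp add: closure_approachable)
    then show ?thesis
      using \<open>closed Q\<close> by simp
  qed
  then have "ball 0 1 \<subseteq> interior Q"
    by (intro interior_maximal) auto
  then have "interior Q \<noteq> {}"
    by (metis ball_eq_empty not_one_le_zero subset_empty)
  then obtain k where "interior ((+) (L k) ` P) \<noteq> {}"
    using interior_finite_Union_closed[OF finW cl, of "\<lambda>k. k"] unfolding Q_def by blast
  then show ?thesis
    by (simp add: interior_translation P_def)
qed

section \<open>Necklaces of continua around a point\<close>

lemma circle_param_dist:
  "dist (exp (2 * of_real pi * \<i> * of_real s)) (exp (2 * of_real pi * \<i> * of_real t)) \<le> 2 * pi * \<bar>s - t\<bar>"
proof -
  have "exp (2 * of_real pi * \<i> * of_real s) - exp (2 * of_real pi * \<i> * of_real t)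
      = exp (\<i> * of_real (2 * pi * t)) * (exp (\<i> * of_real (2 * pi * (s - t))) - 1)"
    by (simp add: algebra_simps flip: exp_add)
  then have "dist (exp (2 * of_real pi * \<i> * of_real s)) (exp (2 * of_real pi * \<i> * of_real t))
      = 2 * \<bar>sin (2 * pi * (s - t) / 2)\<bar>"
    by (simp only: dist_norm norm_mult dist_exp_i_1 norm_exp_i_times)
  also have "\<dots> \<le> 2 * \<bar>2 * pi * (s - t) / 2\<bar>"
    using abs_sin_x_le_abs_x by (simp del: abs_divide)
  finally show ?thesis
    by (simp add: abs_mult)
qed

text \<open>The sets \<open>K \<zeta>\<close> form a closed chain of beads around the circle. If the chain missed
  \<open>E\<close>, then \<open>p\<close> and \<open>q\<close> would lie in one component of the complement of finitely many beads and
  could be joined there by a path \<open>h\<close>. A loop that runs through these beads closely enough misses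
  \<open>h\<close> too, although it winds once around \<open>p\<close>, being close to the circle, and not at all around the
  distant point \<open>q\<close>. The passage from \<open>E\<close> to \<open>h\<close> is what makes an arbitrary connected set
  \<open>E\<close> admissible: the path is compact and so has positive distance from the beads.\<close>

lemma necklace_meets_connected:
  fixes K :: "complex \<Rightarrow> complex set"
  assumes "0 < R" and "0 < \<delta>"
    and conn: "\<And>\<zeta>. \<zeta> \<in> sphere p R \<Longrightarrow> connected (K \<zeta>)"
    and comp: "\<And>\<zeta>. \<zeta> \<in> sphere p R \<Longrightarrow> compact (K \<zeta>)"
    and near: "\<And>\<zeta>. \<zeta> \<in> sphere p R \<Longrightarrow> K \<zeta> \<subseteq> ball \<zeta> (R / 2)"
    and link: "\<And>\<zeta> \<zeta>'. \<zeta> \<in> sphere p R \<Longrightarrow> \<zeta>' \<in> sphere p R \<Longrightarrow> dist \<zeta> \<zeta>' < \<delta> \<Longrightarrow> K \<zeta> \<inter> K \<zeta>' \<noteq> {}"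
    and E: "connected E" "p \<in> E" "q \<in> E" "2 * R \<le> dist p q"
  shows "\<exists>\<zeta>\<in>sphere p R. E \<inter> K \<zeta> \<noteq> {}"
proof (rule ccontr)
  assume "\<not> ?thesis"
  then have disj: "E \<inter> K \<zeta> = {}" if "\<zeta> \<in> sphere p R" for \<zeta>
    using that by blast
  define \<eta> where "\<eta> = min \<delta> (R / 4)"
  have \<eta>: "0 < \<eta>" using assms by (simp add: \<eta>_def)
  obtain n :: nat where n: "2 * pi * R / \<eta> < real n"
    using reals_Archimedean2 by blast
  have "0 < 2 * pi * R / \<eta>" using \<eta> \<open>0 < R\<close> by simp
  with n have n0: "0 < real n" by linarith
  have step: "2 * pi * R / real n < \<eta>"
    using n n0 \<eta> by (simp add: field_simps)
  define \<zeta> where "\<zeta> i = circlepath p R (of_int i / real n)" for i :: int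
  have cdist: "dist (circlepath p R s) (circlepath p R t) \<le> 2 * pi * R * \<bar>s - t\<bar>" for s t
  proof -
    have "dist (circlepath p R s) (circlepath p R t)
        = R * dist (exp (2 * of_real pi * \<i> * of_real s)) (exp (2 * of_real pi * \<i> * of_real t))"
      using \<open>0 < R\<close> by (simp add: circlepath dist_norm norm_mult flip: right_diff_distrib)
    also have "\<dots> \<le> R * (2 * pi * \<bar>s - t\<bar>)"
      using \<open>0 < R\<close> circle_param_dist by (intro mult_left_mono) auto
    finally show ?thesis by (simp add: algebra_simps)
  qed
  have \<zeta>: "\<zeta> i \<in> sphere p R" for i
    using \<open>0 < R\<close> by (simp add: \<zeta>_def circlepath dist_norm norm_mult norm_exp_eq_Re)
  have \<zeta>dist: "dist (\<zeta> i) (\<zeta> (i + 1)) < \<eta>" for i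
  proof -
    have "dist (\<zeta> i) (\<zeta> (i + 1)) \<le> 2 * pi * R * (1 / real n)"
      unfolding \<zeta>_def using cdist[of "of_int i / real n" "of_int (i + 1) / real n"] n0
      by (simp add: add_divide_distrib)
    with step show ?thesis by simp
  qed
  have per: "\<zeta> (i + int n) = \<zeta> i" for i
    using n0 unfolding \<zeta>_def circlepath
    by (simp add: add_divide_distrib distrib_left exp_add exp_two_pi_i)
  \<comment> \<open>The choice depends on \<open>\<zeta> i\<close> and \<open>\<zeta> (i + 1)\<close> only,
      so \<open>c\<close> has period \<open>n\<close> and the loop below closes up.\<close>
  define c where "c i = (SOME z. z \<in> K (\<zeta> i) \<inter> K (\<zeta> (i + 1)))" for i
  have c: "c i \<in> K (\<zeta> i)" "c i \<in> K (\<zeta> (i + 1))" for i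
  proof -
    have "K (\<zeta> i) \<inter> K (\<zeta> (i + 1)) \<noteq> {}"
      using link[OF \<zeta> \<zeta>] \<zeta>dist[of i] by (simp add: \<eta>_def)
    then have "c i \<in> K (\<zeta> i) \<inter> K (\<zeta> (i + 1))"
      unfolding c_def by (metis ex_in_conv someI_ex)
    then show "c i \<in> K (\<zeta> i)" "c i \<in> K (\<zeta> (i + 1))" by auto
  qed
  have cper: "c (i + int n) = c i" for i
    unfolding c_def using per[of i] per[of "i + 1"] by (simp add: algebra_simps)
  define U where "U = (\<Union>i\<in>{0..int n}. K (\<zeta> i))"
  have "closed U"
    unfolding U_def using comp[OF \<zeta>] by (intro closed_UN) (auto intro: compact_imp_closed)
  define D where "D = connected_component_set (- U) p"
  have "E \<subseteq> - U"
    using disj[OF \<zeta>] by (auto simp: U_def)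
  then have "E \<subseteq> D"
    unfolding D_def using E by (intro connected_component_maximal)
  have "open D"
    unfolding D_def using \<open>closed U\<close> by (simp add: open_connected_component open_Compl)
  then have "path_connected D"
    by (simp add: connected_open_path_connected D_def)
  then obtain h where h: "path h" "path_image h \<subseteq> D" "pathstart h = p" "pathfinish h = q"
    using E \<open>E \<subseteq> D\<close> unfolding path_connected_def by blast
  have "D \<inter> U = {}"
    unfolding D_def using connected_component_subset by blast
  then have "path_image h \<inter> U = {}" using h by blast
  then obtain r where r: "0 < r" "\<And>x y. x \<in> path_image h \<Longrightarrow> y \<in> U \<Longrightarrow> r \<le> dist x y"
    using separate_compact_closed[OF compact_path_image[OF h(1)] \<open>closed U\<close>] by blast
  define \<epsilon> where "\<epsilon> = min r (R / 4)"
  have \<epsilon>: "0 < \<epsilon>" and \<epsilon>R: "\<epsilon> \<le> R / 4" using r \<open>0 < R\<close> by (simp_all add: \<epsilon>_def)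
  have "\<exists>g. path g \<and> pathstart g = c (i - 1) \<and> pathfinish g = c i \<and>
      (\<forall>t\<in>{0..1}. \<exists>x\<in>K (\<zeta> i). dist x (g t) < \<epsilon>)" for i
    using path_near_connected_set[OF conn[OF \<zeta>[of i]] _ c(1)[of i] \<epsilon>, of "c (i - 1)"] c(2)[of "i - 1"]
    by (metis diff_add_cancel)
  then obtain g where g: "\<And>i. path (g i)" "\<And>i. pathstart (g i) = c (i - 1)" "\<And>i. pathfinish (g i) = c i"
      "\<And>i t. t \<in> {0..1} \<Longrightarrow> \<exists>x\<in>K (\<zeta> i). dist x (g i t) < \<epsilon>"
    by metis
  define G where "G t = g \<lfloor>real n * t\<rfloor> (frac (real n * t))" for t
  have "continuous_on UNIV (\<lambda>t. g \<lfloor>t\<rfloor> (frac t))"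
    using g by (intro continuous_on_concatenated_paths) auto
  then have "path G"
    unfolding path_def G_def
    by (rule continuous_on_compose2[where f = "\<lambda>t. real n * t"]) (auto intro!: continuous_intros)
  have "G 0 = c (-1)" "G 1 = c (int n - 1)"
    using g(2)[of 0] g(2)[of "int n"] by (simp_all add: G_def pathstart_def frac_def)
  then have loop: "pathfinish G = pathstart G"
    using cper[of "-1"] by (simp add: pathfinish_def pathstart_def)
  have Gnear: "\<exists>i\<in>{0..int n}. \<bar>t - of_int i / real n\<bar> \<le> 1 / real n \<and> (\<exists>x\<in>K (\<zeta> i). dist x (G t) < \<epsilon>)"
    if t: "t \<in> {0..1}" for t
  proof -
    let ?i = "\<lfloor>real n * t\<rfloor>"
    have "real n * t \<le> real n" "0 \<le> real n * t"
      using t n0 by (auto simp: mult_left_le)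
    then have "?i \<in> {0..int n}"
      by (simp add: floor_le_iff)
    have "\<bar>t - of_int ?i / real n\<bar> = \<bar>real n * t - of_int ?i\<bar> / real n"
    proof -
      have "t - of_int ?i / real n = (real n * t - of_int ?i) / real n"
        using n0 by (simp add: field_simps)
      then show ?thesis
        by (simp add: abs_divide)
    qed
    also have "\<dots> \<le> 1 / real n"
      using n0 by (intro divide_right_mono) linarith+
    finally have "\<bar>t - of_int ?i / real n\<bar> \<le> 1 / real n" .
    moreover have "\<exists>x\<in>K (\<zeta> ?i). dist x (G t) < \<epsilon>"
      unfolding G_def using g(4) by (simp add: frac_lt_1 less_imp_le)
    ultimately show ?thesis
      using \<open>?i \<in> {0..int n}\<close> by blast
  qed
  have close: "dist (G t) (circlepath p R t) < R" if t: "t \<in> {0..1}" for t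
  proof -
    obtain i x where i: "\<bar>t - of_int i / real n\<bar> \<le> 1 / real n" "x \<in> K (\<zeta> i)" "dist x (G t) < \<epsilon>"
      using Gnear[OF t] by blast
    have "dist (\<zeta> i) (circlepath p R t) \<le> 2 * pi * R * (1 / real n)"
      using cdist[of t "of_int i / real n"] i(1) \<open>0 < R\<close>
      unfolding \<zeta>_def by (smt (verit) dist_commute mult_left_mono pi_gt_zero mult_nonneg_nonneg)
    then have "dist (\<zeta> i) (circlepath p R t) < R / 4"
      using step by (simp add: \<eta>_def)
    moreover have "dist (\<zeta> i) x < R / 2"
      using near[OF \<zeta>[of i]] i(2) mem_ball by blast
    ultimately show ?thesis
      using i(3) dist_triangle[of "G t" "circlepath p R t" x]
        dist_triangle3[of x "circlepath p R t" "\<zeta> i"] \<epsilon>R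
      by (simp add: dist_commute[of "G t" x])
  qed
  have wn: "winding_number G z = winding_number (circlepath p R) z"
    if "\<And>t. t \<in> {0..1} \<Longrightarrow> R \<le> dist (circlepath p R t) z" for z
    using close that
    by (intro winding_number_nearby_loops_eq)
       (use \<open>path G\<close> loop in \<open>force simp: dist_norm\<close>)+
  have onC: "dist p (circlepath p R t) = R" for t
    using \<open>0 < R\<close> by (simp add: circlepath dist_norm norm_mult norm_exp_eq_Re)
  have "winding_number G p = 1"
    using wn[of p] onC \<open>0 < R\<close> by (simp add: dist_commute winding_number_circlepath)
  moreover have "winding_number G q = 0"
  proof -
    have "R \<le> dist (circlepath p R t) q" for t
      using onC[of t] E(4) dist_triangle[of p q "circlepath p R t"] by linarith
    then have "winding_number G q = winding_number (circlepath p R) q"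
      by (rule wn)
    also have "\<dots> = 0"
      using E(4) \<open>0 < R\<close>
      by (intro winding_number_zero_outside[of _ "cball p R"])
         (auto simp: path_image_circlepath)
    finally show ?thesis .
  qed
  moreover have "winding_number G p = winding_number G q"
  proof (rule winding_number_eq[OF \<open>path G\<close> loop])
    show "p \<in> path_image h" "q \<in> path_image h"
      using h by (metis pathstart_in_path_image pathfinish_in_path_image)+
    show "connected (path_image h)"
      using h(1) by (rule connected_path_image)
    show "path_image h \<inter> path_image G = {}"
    proof (rule ccontr)
      assume "path_image h \<inter> path_image G \<noteq> {}"
      then obtain t where t: "t \<in> {0..1}" "G t \<in> path_image h"
        unfolding path_image_def[of G] by blast
      then obtain i x where "i \<in> {0..int n}" "x \<in> K (\<zeta> i)" "dist x (G t) < \<epsilon>"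
        using Gnear by blast
      then have "x \<in> U"
        unfolding U_def by blast
      then show False
        using r(2)[OF t(2), of x] \<open>dist x (G t) < \<epsilon>\<close> by (simp add: \<epsilon>_def dist_commute)
    qed
  qed
  ultimately show False by simp
qed

text \<open>If \<open>E + F\<close> has empty interior, then its complement is dense, and \<open>x - F\<close> misses \<open>E\<close> for
  each \<open>x\<close> in the complement. The translates \<open>x - A\<close> and \<open>y - B\<close> meet whenever \<open>x - y\<close> lies
  in \<open>A - B\<close>; since that set contains a disc, say around \<open>w\<close>, they still meet when \<open>x - y\<close> is
  only approximately \<open>w\<close>. So \<open>x\<close> and \<open>y\<close> can be taken from the dense complement, and such pairs of
  translates are the beads of a necklace around \<open>p\<close> that misses \<open>E\<close>. The bounds on the diameters
  ensure that the necklace does not enclose \<open>q\<close>.\<close>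

lemma interior_sum_of_linked_continua:
  fixes E F A B :: "complex set"
  assumes E: "connected E" "p \<in> E" "q \<in> E" "p \<noteq> q"
    and A: "compact A" "connected A" "A \<subseteq> F"
    and B: "compact B" "connected B" "B \<subseteq> F"
    and Adiam: "\<And>x y. x \<in> A \<Longrightarrow> y \<in> A \<Longrightarrow> dist x y \<le> dist p q / 16"
    and Bdiam: "\<And>x y. x \<in> B \<Longrightarrow> y \<in> B \<Longrightarrow> dist x y \<le> dist p q / 16"
    and AB: "interior {x - y | x y. x \<in> A \<and> y \<in> B} \<noteq> {}"
  shows "interior (E + F) \<noteq> {}"
proof
  assume int: "interior (E + F) = {}"
  define R where "R = dist p q / 2"
  have R: "0 < R" using E by (simp add: R_def)
  obtain w where "w \<in> interior {x - y | x y. x \<in> A \<and> y \<in> B}"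
    using AB by blast
  then obtain s where s: "0 < s" "ball w s \<subseteq> {x - y | x y. x \<in> A \<and> y \<in> B}"
    unfolding mem_interior by blast
  define \<sigma> where "\<sigma> = min (s / 4) (R / 8)"
  have \<sigma>: "0 < \<sigma>" "4 * \<sigma> \<le> s" "\<sigma> \<le> R / 8"
    using s R by (auto simp: \<sigma>_def)
  have "\<exists>x. x \<notin> E + F \<and> dist x z < \<sigma>" for z
  proof -
    have "\<not> ball z \<sigma> \<subseteq> E + F"
      using int \<sigma>(1) mem_interior[of z "E + F"] by blast
    then show ?thesis
      by (auto simp: dist_commute)
  qed
  then obtain X where X: "\<And>z. X z \<notin> E + F" "\<And>z. dist (X z) z < \<sigma>"
    by metis
  obtain a where a: "a \<in> A"
    using s centre_in_ball[of w s] by blast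
  define x where "x \<zeta> = X (a + \<zeta>)" for \<zeta>
  \<comment> \<open>The set \<open>y \<zeta> - B\<close> meets \<open>x \<zeta> - A\<close> and also \<open>x \<zeta>' - A\<close> for all nearby \<open>\<zeta>'\<close>; this links neighbouring beads.\<close>
  define y where "y \<zeta> = X (x \<zeta> - w)" for \<zeta>
  define K where "K \<zeta> = (\<lambda>z. x \<zeta> - z) ` A \<union> (\<lambda>z. y \<zeta> - z) ` B" for \<zeta>
  have meet: "(\<lambda>z. x \<zeta>' - z) ` A \<inter> (\<lambda>z. y \<zeta> - z) ` B \<noteq> {}" if "dist \<zeta> \<zeta>' < \<sigma>" for \<zeta> \<zeta>'
  proof -
    have "norm (x \<zeta>' - y \<zeta> - w) < s"
    proof -
      have "x \<zeta>' - y \<zeta> - w =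
          (x \<zeta>' - (a + \<zeta>')) - (x \<zeta> - (a + \<zeta>)) - (y \<zeta> - (x \<zeta> - w)) - (\<zeta> - \<zeta>')"
        by simp
      also have "norm \<dots> \<le> dist (x \<zeta>') (a + \<zeta>') + dist (x \<zeta>) (a + \<zeta>)
          + dist (y \<zeta>) (x \<zeta> - w) + dist \<zeta> \<zeta>'"
        unfolding dist_norm by (meson norm_triangle_ineq4 order_trans add_mono order_refl)
      also have "\<dots> < s"
        using X(2)[of "a + \<zeta>'"] X(2)[of "a + \<zeta>"] X(2)[of "x \<zeta> - w"] that \<sigma>(2)
        unfolding x_def y_def by linarith
      finally show ?thesis .
    qed
    then have "x \<zeta>' - y \<zeta> \<in> ball w s"
      by (simp add: dist_norm norm_minus_commute)
    then obtain u v where uv: "u \<in> A" "v \<in> B" "x \<zeta>' - y \<zeta> = u - v"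
      using s(2) by blast
    then have "x \<zeta>' - u = y \<zeta> - v"
      by (simp add: algebra_simps)
    then show ?thesis
      using uv(1,2) by blast
  qed
  have avoid: "E \<inter> K \<zeta> = {}" for \<zeta>
  proof -
    have "X z - f \<notin> E" if "f \<in> F" for z f
      using set_plus_intro[of "X z - f" E f F] X(1)[of z] that by auto
    then show ?thesis
      using A(3) B(3) unfolding K_def x_def y_def by blast
  qed
  have "\<exists>\<zeta>\<in>sphere p R. E \<inter> K \<zeta> \<noteq> {}"
  proof (rule necklace_meets_connected[OF R \<sigma>(1) _ _ _ _ E(1-3)])
    fix \<zeta>
    show "connected (K \<zeta>)"
      unfolding K_def using meet[of \<zeta> \<zeta>] \<sigma>(1) A(2) B(2)
      by (intro connected_Un connected_continuous_image) (auto intro!: continuous_intros)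
    show "compact (K \<zeta>)"
      unfolding K_def using A(1) B(1)
      by (intro compact_Un compact_continuous_image) (auto intro!: continuous_intros)
    have Anear: "dist \<zeta> (x \<zeta> - u) < \<sigma> + R / 8" if "u \<in> A" for u
    proof -
      have "\<zeta> - (x \<zeta> - u) = (u - a) - (x \<zeta> - (a + \<zeta>))" by simp
      also have "norm \<dots> \<le> dist u a + dist (x \<zeta>) (a + \<zeta>)"
        unfolding dist_norm by (rule norm_triangle_ineq4)
      also have "\<dots> < R / 8 + \<sigma>"
        using Adiam[OF that a] X(2)[of "a + \<zeta>"] unfolding x_def R_def by simp
      finally show ?thesis by (simp add: dist_norm)
    qed
    obtain u v where uv: "u \<in> A" "v \<in> B" "x \<zeta> - u = y \<zeta> - v"
      using meet[of \<zeta> \<zeta>] \<sigma>(1) by auto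
    have Bnear: "dist \<zeta> (y \<zeta> - v') < R / 2" if "v' \<in> B" for v'
    proof -
      have "dist (y \<zeta> - v) (y \<zeta> - v') \<le> R / 8"
        using Bdiam[OF uv(2) that] by (simp add: dist_norm R_def norm_minus_commute)
      then show ?thesis
        using Anear[OF uv(1)] dist_triangle[of \<zeta> "y \<zeta> - v'" "y \<zeta> - v"] uv(3) \<sigma>(3) R by simp
    qed
    show "K \<zeta> \<subseteq> ball \<zeta> (R / 2)"
      unfolding K_def using Anear Bnear \<sigma>(3) R by fastforce
  next
    fix \<zeta> \<zeta>' :: complex assume "dist \<zeta> \<zeta>' < \<sigma>"
    then show "K \<zeta> \<inter> K \<zeta>' \<noteq> {}"
      using meet[of \<zeta> \<zeta>'] unfolding K_def by blast
  qed (simp add: R_def)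
  with avoid show False by blast
qed

section \<open>Small subcontinua in different directions\<close>

text \<open>This is boundary bumping: in a continuum, a component of a proper closed subset meets
  the boundary of that subset.\<close>

lemma component_reaches_sphere:
  fixes F :: "'a::euclidean_space set"
  assumes F: "compact F" "connected F" "f \<in> F" "\<not> F \<subseteq> cball f \<rho>" "0 \<le> \<rho>"
  shows "\<exists>g \<in> connected_component_set (F \<inter> cball f \<rho>) f. dist f g = \<rho>"
proof -
  let ?X = "top_of_set F" and ?S = "F \<inter> cball f \<rho>"
  let ?C = "connected_component_set ?S f"
  have sub: "subtopology ?X ?S = top_of_set ?S"
    by (simp only: subtopology_subtopology Int_left_absorb)
  have "?C \<inter> ?X frontier_of ?S \<noteq> {}"
  proof (rule boundary_bumping_theorem_closed)
    show "connected_space ?X"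
      using F(2) by (simp add: connected_space_subtopology)
    show "compact_space ?X"
      using F(1) by (simp add: compact_space_subtopology)
    show "Hausdorff_space ?X"
      by (simp add: Hausdorff_space_subtopology)
    show "closedin ?X ?S"
      by (simp add: closedin_closed_Int)
    show "?S \<noteq> topspace ?X"
      using F(4) by auto
    show "?C \<in> connected_components_of (subtopology ?X ?S)"
    proof -
      have "Collect (connected_component_of (top_of_set ?S) f) = ?C"
        by (auto simp: connected_component_of_def connected_component_def connectedin_subtopology)
      moreover have "f \<in> ?S"
        using F(3,5) by simp
      ultimately show ?thesis
        unfolding sub connected_components_of_def by auto
    qed
  qed
  then obtain g where g: "g \<in> ?C" "g \<in> ?X frontier_of ?S" by blast
  have "openin ?X (F \<inter> ball f \<rho>)"
    by (simp add: openin_open_Int)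
  then have "F \<inter> ball f \<rho> \<subseteq> ?X interior_of ?S"
    by (intro interior_of_maximal) auto
  then have "g \<notin> F \<inter> ball f \<rho>"
    using g(2) by (auto simp: frontier_of_def)
  moreover have "g \<in> ?S"
    using g(1) connected_component_subset by blast
  ultimately show ?thesis
    using g(1) by (intro bexI[of _ g]) auto
qed

text \<open>Boundary bumping provides every \<open>f \<in> F\<close> with a subcontinuum \<open>C f\<close> of diameter at most
  \<open>r\<close> that reaches from \<open>f\<close> to distance \<open>\<rho>\<close>. Suppose that all chords of all these sets are
  parallel to one vector \<open>w\<close>, and use the coordinates \<open>w \<bullet> z\<close> along \<open>w\<close> and \<open>cross w z\<close>
  across it. Then \<open>C f\<close> contains a segment of length \<open>\<rho>\<close> in direction \<open>w\<close>, which hits one of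
  finitely many equidistant lines perpendicular to \<open>w\<close>. If \<open>F\<close> is not contained in a line
  parallel to \<open>w\<close>, the coordinates across \<open>w\<close> of points of \<open>F\<close> fill an interval, which is thus a
  finite union of closed sets, one for each of these lines. One of the closed sets has an interior
  point, and then \<open>F\<close> contains a segment perpendicular to \<open>w\<close>, a short piece of which lies in
  the set \<open>C f\<close> of its starting point \<open>f\<close>: a contradiction. If \<open>F\<close> is contained in a line
  parallel to \<open>w\<close>, it is a segment.\<close>

lemma nonparallel_small_subcontinua:
  fixes F :: "complex set"
  assumes F: "compact F" "connected F" "f\<^sub>1 \<in> F" "f\<^sub>2 \<in> F" "f\<^sub>1 \<noteq> f\<^sub>2"
    and nseg: "\<not> (\<exists>p q. p \<noteq> q \<and> F = closed_segment p q)"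
    and r: "0 < r"
  obtains A B a a' b b' where
    "compact A" "connected A" "A \<subseteq> F" "\<And>x y. x \<in> A \<Longrightarrow> y \<in> A \<Longrightarrow> dist x y \<le> r" "a \<in> A" "a' \<in> A"
    "compact B" "connected B" "B \<subseteq> F" "\<And>x y. x \<in> B \<Longrightarrow> y \<in> B \<Longrightarrow> dist x y \<le> r" "b \<in> B" "b' \<in> B"
    "cross (a' - a) (b' - b) \<noteq> 0"
proof (rule ccontr)
  note found = that
  assume no: "\<not> thesis"
  \<comment> \<open>Small enough that no closed ball of radius \<open>\<rho>\<close> contains \<open>F\<close>.\<close>
  define \<rho> where "\<rho> = min (r / 2) (dist f\<^sub>1 f\<^sub>2 / 3)"
  have \<rho>: "0 < \<rho>" "2 * \<rho> \<le> r" "3 * \<rho> \<le> dist f\<^sub>1 f\<^sub>2"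
    using r F(5) by (auto simp: \<rho>_def)
  define C where "C f = connected_component_set (F \<inter> cball f \<rho>) f" for f
  have C: "compact (C f)" "connected (C f)" "C f \<subseteq> F" "C f \<subseteq> cball f \<rho>" for f
  proof -
    show "compact (C f)"
    proof -
      have cl: "closed (F \<inter> cball f \<rho>)"
        using F(1) by (simp add: closed_Int compact_imp_closed)
      have "C f = F \<inter> C f"
        unfolding C_def using connected_component_subset[of "F \<inter> cball f \<rho>" f] by blast
      moreover have "compact (F \<inter> C f)"
        unfolding C_def by (intro compact_Int_closed closed_connected_component F(1) cl)
      ultimately show ?thesis by simp
    qed
    show "connected (C f)" by (simp add: C_def)
    show "C f \<subseteq> F" "C f \<subseteq> cball f \<rho>"
      unfolding C_def using connected_component_subset[of "F \<inter> cball f \<rho>" f] by blast+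
  qed
  have self: "f \<in> C f" if "f \<in> F" for f
    using that \<rho>(1) by (simp add: C_def)
  have Cdiam: "dist x y \<le> r" if "x \<in> C f" "y \<in> C f" for x y f
  proof -
    have "dist f x \<le> \<rho>" "dist f y \<le> \<rho>"
      using C(4)[of f] that mem_cball by blast+
    then show ?thesis
      using \<rho>(2) dist_triangle3[of x y f] by linarith
  qed
  have bump: "\<exists>g\<in>C f. dist f g = \<rho>" if "f \<in> F" for f
  proof -
    have "\<not> F \<subseteq> cball f \<rho>"
    proof
      assume "F \<subseteq> cball f \<rho>"
      then have "dist f f\<^sub>1 \<le> \<rho>" "dist f f\<^sub>2 \<le> \<rho>"
        using F(3,4) by auto
      then show False
        using \<rho> dist_triangle3[of f\<^sub>1 f\<^sub>2 f] by simp
    qed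
    then show ?thesis
      unfolding C_def using component_reaches_sphere[OF F(1,2) that] \<rho>(1) by simp
  qed
  have par: "cross (a' - a) (b' - b) = 0"
    if "f \<in> F" "g \<in> F" "a \<in> C f" "a' \<in> C f" "b \<in> C g" "b' \<in> C g" for f g a a' b b'
  proof (rule ccontr)
    assume "cross (a' - a) (b' - b) \<noteq> 0"
    then have thesis
      by (intro found[where A = "C f" and B = "C g" and a = a and a' = a' and b = b and b' = b'])
         (use that(3-6) C Cdiam in \<open>simp_all\<close>)
    with no show False ..
  qed
  obtain g\<^sub>1 where g\<^sub>1: "g\<^sub>1 \<in> C f\<^sub>1" "dist f\<^sub>1 g\<^sub>1 = \<rho>"
    using bump[OF F(3)] by blast
  define w where "w = g\<^sub>1 - f\<^sub>1"
  have nw: "norm w = \<rho>"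
    using g\<^sub>1 by (simp add: w_def dist_norm norm_minus_commute)
  then have w0: "w \<noteq> 0" using \<rho> by auto
  have level: "cross w b = cross w f" if "f \<in> F" "b \<in> C f" for f b
    using par[OF F(3) that(1) self[OF F(3)] g\<^sub>1(1) self[OF that(1)] that(2)]
    by (simp add: w_def cross_def algebra_simps)
  have pyth: "(inner w z)\<^sup>2 + (cross w z)\<^sup>2 = \<rho>\<^sup>2 * (norm z)\<^sup>2" for z
  proof -
    have "(norm (cnj w * z))\<^sup>2 = \<rho>\<^sup>2 * (norm z)\<^sup>2"
      by (simp add: norm_mult nw power_mult_distrib)
    then show ?thesis
      by (simp add: inner_complex_def cross_def cmod_power2)
  qed
  have coords: "z = Complex (inner w z) (cross w z) / cnj w" for z
  proof -
    have "Complex (inner w z) (cross w z) = cnj w * z"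
      by (simp add: inner_complex_def cross_def complex_eq_iff)
    then show ?thesis
      using w0 by simp
  qed
  have cdot: "continuous_on S (inner w)" for S
    by (intro continuous_intros)
  have ccross: "continuous_on S (cross w)" for S
    unfolding cross_def by (intro continuous_intros)
  \<comment> \<open>Since \<open>norm w = \<rho>\<close>, moving by \<open>\<rho>\<close> in direction \<open>w\<close> changes \<open>w \<bullet> z\<close> by \<open>\<tau>\<close>, the spacing of the lines.\<close>
  define \<tau> where "\<tau> = \<rho>\<^sup>2"
  have \<tau>: "0 < \<tau>" using \<rho> by (simp add: \<tau>_def)
  define S where "S k = {z \<in> F. inner w z = of_int k * \<tau>}" for k :: int
  have hits: "\<exists>k. \<exists>z\<in>S k. cross w z = cross w f" if f: "f \<in> F" for f
  proof -
    obtain g where g: "g \<in> C f" "dist f g = \<rho>"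
      using bump[OF f] by blast
    have "(inner w (g - f))\<^sup>2 + (cross w (g - f))\<^sup>2 = \<tau>\<^sup>2"
      using pyth[of "g - f"] g(2) by (simp add: dist_norm norm_minus_commute \<tau>_def power2_eq_square)
    moreover have "cross w (g - f) = 0"
      using level[OF f g(1)] by (simp add: cross_diff_right)
    ultimately have "\<bar>inner w (g - f)\<bar> = \<tau>"
      using \<tau> by (simp add: power2_eq_iff abs_if) linarith
    then have gap: "\<bar>inner w g - inner w f\<bar> = \<tau>"
      by (simp add: inner_complex_def algebra_simps)
    define m where "m = min (inner w f) (inner w g)"
    define k where "k = \<lceil>m / \<tau>\<rceil>"
    have "m / \<tau> \<le> of_int k" "of_int k < m / \<tau> + 1"
      unfolding k_def by linarith+
    then have "m \<le> of_int k * \<tau>" "of_int k * \<tau> < m + \<tau>"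
      using \<tau> by (simp_all add: field_simps)
    moreover have "connected (inner w ` C f)"
      by (intro connected_continuous_image cdot C)
    then have "is_interval (inner w ` C f)"
      by (simp add: is_interval_connected_1)
    moreover have "inner w f \<in> inner w ` C f" "inner w g \<in> inner w ` C f"
      using self[OF f] g(1) by auto
    ultimately have "of_int k * \<tau> \<in> inner w ` C f"
      using gap unfolding m_def is_interval_1 by (smt (verit, best))
    then obtain z where "z \<in> C f" "inner w z = of_int k * \<tau>"
      by auto
    then show ?thesis
      using level[OF f, of z] C(3)[of f] by (intro exI[of _ k] bexI[of _ z]) (auto simp: S_def)
  qed
  obtain M where M: "\<And>z. z \<in> F \<Longrightarrow> \<bar>inner w z\<bar> \<le> M"
  proof -
    have "compact (inner w ` F)"
      by (intro compact_continuous_image cdot F)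
    then show thesis
      using that compact_imp_bounded bounded_real by (metis imageI)
  qed
  define I where "I = {k :: int. \<bar>k\<bar> \<le> \<lceil>M / \<tau>\<rceil>}"
  have "finite I"
  proof (rule finite_subset)
    show "I \<subseteq> {- \<lceil>M / \<tau>\<rceil>..\<lceil>M / \<tau>\<rceil>}" by (auto simp: I_def)
  qed simp
  have SI: "k \<in> I" if "z \<in> S k" for k z
  proof -
    have "\<bar>of_int k\<bar> * \<tau> \<le> M"
      using M[of z] that \<tau> by (auto simp: S_def abs_mult)
    then have "\<bar>of_int k\<bar> \<le> M / \<tau>"
      using \<tau> by (simp add: field_simps)
    then show ?thesis
      unfolding I_def by (simp add: le_ceiling_iff)
  qed
  show False
  proof (cases "\<forall>z\<in>F. cross w z = cross w f\<^sub>1")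
    case True
    have "collinear F"
      unfolding collinear_def
    proof (intro exI[of _ "1 / cnj w"] ballI)
      fix x y assume xy: "x \<in> F" "y \<in> F"
      have "cross w (x - y) = 0"
        using True xy by (simp add: cross_diff_right)
      then have "x - y = of_real (inner w (x - y)) / cnj w"
        by (subst coords[of "x - y"]) (simp add: complex_of_real_def)
      then show "\<exists>c. x - y = c *\<^sub>R (1 / cnj w)"
        by (intro exI[of _ "inner w (x - y)"]) (simp add: scaleR_conv_of_real)
    qed
    then obtain p q where pq: "F = closed_segment p q"
      using compact_convex_collinear_segment_alt[of F] F(1-3) by blast
    then have "p \<noteq> q"
      using F(3-5) by auto
    with pq nseg show False by blast
  next
    case False
    then obtain f\<^sub>3 where f\<^sub>3: "f\<^sub>3 \<in> F" "cross w f\<^sub>3 \<noteq> cross w f\<^sub>1" by blast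
    define N where "N = cross w ` F"
    have "is_interval N"
      unfolding N_def is_interval_connected_1 by (intro connected_continuous_image ccross F)
    moreover define l u where "l = min (cross w f\<^sub>1) (cross w f\<^sub>3)"
      and "u = max (cross w f\<^sub>1) (cross w f\<^sub>3)"
    have "l \<in> N" "u \<in> N"
      using F(3) f\<^sub>3(1) by (auto simp: l_def u_def N_def min_def max_def)
    ultimately have "{l<..<u} \<subseteq> N"
      unfolding is_interval_1 by (meson greaterThanLessThan_iff less_imp_le subsetI)
    then have "{l<..<u} \<subseteq> interior N"
      by (intro interior_maximal) auto
    moreover have "l < u"
      using f\<^sub>3(2) by (auto simp: l_def u_def min_def max_def)
    ultimately have "interior N \<noteq> {}"
      using dense[of l u] by auto
    moreover have "N \<subseteq> (\<Union>k\<in>I. cross w ` S k)"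
    proof
      fix y assume "y \<in> N"
      then obtain f where "f \<in> F" "y = cross w f"
        unfolding N_def by blast
      then obtain k z where "z \<in> S k" "y = cross w z"
        using hits by metis
      then show "y \<in> (\<Union>k\<in>I. cross w ` S k)"
        using SI by blast
    qed
    ultimately have "interior (\<Union>k\<in>I. cross w ` S k) \<noteq> {}"
      using interior_mono[of N "\<Union>k\<in>I. cross w ` S k"] by blast
    moreover have "closed (cross w ` S k)" for k
    proof -
      have "S k = F \<inter> inner w -` {of_int k * \<tau>}"
        by (auto simp: S_def)
      moreover have "closed (inner w -` {of_int k * \<tau>})"
        by (intro closed_vimage cdot) auto
      ultimately have "compact (S k)"
        using F(1) by (simp add: compact_Int_closed)
      then show ?thesis
        by (intro compact_imp_closed compact_continuous_image ccross)
    qed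
    ultimately obtain k where "interior (cross w ` S k) \<noteq> {}"
      using interior_finite_Union_closed[OF \<open>finite I\<close>, of "\<lambda>k. cross w ` S k"] by blast
    then obtain y0 where "y0 \<in> interior (cross w ` S k)"
      by blast
    then obtain e where e: "0 < e" "ball y0 e \<subseteq> cross w ` S k"
      unfolding mem_interior by blast
    \<comment> \<open>The point with coordinates \<open>k \<tau>\<close> and \<open>y\<close>, running along the \<open>k\<close>-th perpendicular line.\<close>
    define \<gamma> where "\<gamma> y = Complex (of_int k * \<tau>) y / cnj w" for y
    have \<gamma>F: "\<gamma> y \<in> F" "cross w (\<gamma> y) = y" if y: "y \<in> ball y0 e" for y
    proof -
      obtain z where z: "z \<in> F" "inner w z = of_int k * \<tau>" "cross w z = y"
        using e(2) y unfolding S_def by blast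
      then have "\<gamma> y = z"
        by (subst coords[of z]) (simp add: \<gamma>_def)
      with z show "\<gamma> y \<in> F" "cross w (\<gamma> y) = y" by auto
    qed
    have \<gamma>dist: "dist (\<gamma> y) (\<gamma> y') = \<bar>y - y'\<bar> / \<rho>" for y y'
    proof -
      have "\<gamma> y - \<gamma> y' = Complex 0 (y - y') / cnj w"
        by (simp add: \<gamma>_def complex_diff flip: diff_divide_distrib)
      then show ?thesis
        by (simp add: dist_norm norm_divide nw complex_norm)
    qed
    define h where "h = min (e / 2) (\<rho> * \<rho>)"
    have h: "0 < h" "h < e" "h \<le> \<rho> * \<rho>"
      using e(1) \<rho>(1) by (auto simp: h_def)
    have "connected (\<gamma> ` {y0..y0 + h})"
    proof (intro connected_continuous_image)
      have "\<gamma> = (\<lambda>y. (of_real (of_int k * \<tau>) + \<i> * of_real y) / cnj w)"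
        by (simp add: \<gamma>_def fun_eq_iff Complex_eq)
      then show "continuous_on {y0..y0 + h} \<gamma>"
        using w0 by (auto intro!: continuous_intros)
    qed simp
    moreover have "\<gamma> ` {y0..y0 + h} \<subseteq> F \<inter> cball (\<gamma> y0) \<rho>"
    proof
      fix z assume "z \<in> \<gamma> ` {y0..y0 + h}"
      then obtain y where y: "z = \<gamma> y" "y0 \<le> y" "y \<le> y0 + h" by auto
      then have "y \<in> ball y0 e"
        using h by (simp add: dist_real_def)
      moreover have "\<bar>y0 - y\<bar> / \<rho> \<le> \<rho>"
        using y h \<rho>(1) by (simp add: field_simps)
      ultimately show "z \<in> F \<inter> cball (\<gamma> y0) \<rho>"
        using \<gamma>F y(1) \<gamma>dist by simp
    qed
    moreover have "\<gamma> y0 \<in> \<gamma> ` {y0..y0 + h}"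
      using h by auto
    ultimately have "\<gamma> ` {y0..y0 + h} \<subseteq> C (\<gamma> y0)"
      unfolding C_def by (intro connected_component_maximal)
    then have "\<gamma> (y0 + h) \<in> C (\<gamma> y0)"
      using h by auto
    then have "cross w (\<gamma> (y0 + h)) = cross w (\<gamma> y0)"
      using level \<gamma>F(1)[of y0] e(1) by simp
    then show False
      using \<gamma>F(2)[of y0] \<gamma>F(2)[of "y0 + h"] h e(1) by (simp add: dist_real_def)
  qed
qed

section \<open>Sums of connected plane sets\<close>

lemma interior_sum_connected_continuum_complex:
  fixes E F :: "complex set"
  assumes E: "connected E" "p \<in> E" "q \<in> E" "p \<noteq> q"
    and F: "compact F" "connected F" "f\<^sub>1 \<in> F" "f\<^sub>2 \<in> F" "f\<^sub>1 \<noteq> f\<^sub>2"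
    and nseg: "\<not> (\<exists>p q. p \<noteq> q \<and> F = closed_segment p q)"
  shows "interior (E + F) \<noteq> {}"
proof -
  have "0 < dist p q / 16" using E(4) by simp
  then obtain A B a a' b b' where
    A: "compact A" "connected A" "A \<subseteq> F" "\<And>x y. x \<in> A \<Longrightarrow> y \<in> A \<Longrightarrow> dist x y \<le> dist p q / 16" "a \<in> A" "a' \<in> A"
    and B: "compact B" "connected B" "B \<subseteq> F" "\<And>x y. x \<in> B \<Longrightarrow> y \<in> B \<Longrightarrow> dist x y \<le> dist p q / 16" "b \<in> B" "b' \<in> B"
    and ab: "cross (a' - a) (b' - b) \<noteq> 0"
    by (rule nonparallel_small_subcontinua[OF F nseg]) blast
  \<comment> \<open>The set of differences \<open>A - B\<close> is the sum of the continua \<open>A\<close> and \<open>-B\<close>.\<close>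
  have "interior {x + y | x y. x \<in> A \<and> y \<in> uminus ` B} \<noteq> {}"
  proof (rule interior_sum_of_continua[OF A(1,2,5,6)])
    show "compact (uminus ` B)" "connected (uminus ` B)"
      using B(1,2) by (auto intro!: compact_continuous_image connected_continuous_image continuous_intros)
    show "- b \<in> uminus ` B" "- b' \<in> uminus ` B" using B by auto
    show "cross (a' - a) (- b' - - b) \<noteq> 0"
      using ab by (simp add: cross_def algebra_simps)
  qed
  moreover have "{x + y | x y. x \<in> A \<and> y \<in> uminus ` B} = {x - y | x y. x \<in> A \<and> y \<in> B}"
    by force
  ultimately show ?thesis
    using interior_sum_of_linked_continua[OF E A(1-3) B(1-3) A(4) B(4)] by simp
qed

theorem theorem1p2:
  fixes E F :: "(real ^ 2) set"
  assumes "connected E" and "connected F"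
    and "\<exists>x\<in>E. \<exists>y\<in>E. x \<noteq> y" and "\<exists>x\<in>F. \<exists>y\<in>F. x \<noteq> y"
    and "compact F"
    and "\<not> (\<exists>p q. p \<noteq> q \<and> F = closed_segment p q)"
  shows "interior (E + F) \<noteq> {}"
proof -
  define \<phi> :: "real ^ 2 \<Rightarrow> complex" where "\<phi> v = Complex (v $ 1) (v $ 2)" for v
  define \<psi> :: "complex \<Rightarrow> real ^ 2" where "\<psi> z = vector [Re z, Im z]" for z
  have \<psi>\<phi>: "\<psi> (\<phi> v) = v" and \<phi>\<psi>: "\<phi> (\<psi> z) = z" for v z
    by (simp_all add: \<phi>_def \<psi>_def vec_eq_iff forall_2 complex_eq_iff)
  have lin: "linear \<phi>" "linear \<psi>"
    by (rule linearI; simp add: \<phi>_def \<psi>_def vec_eq_iff forall_2 complex_eq_iff)+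
  have image: "\<psi> ` \<phi> ` S = S" for S
    by (simp add: image_image \<psi>\<phi>)
  have inj: "inj \<phi>" by (metis \<psi>\<phi> injI)
  obtain p q f g where pts: "p \<in> E" "q \<in> E" "p \<noteq> q" "f \<in> F" "g \<in> F" "f \<noteq> g"
    using assms(3,4) by blast
  have "interior (\<phi> ` E + \<phi> ` F) \<noteq> {}"
  proof (rule interior_sum_connected_continuum_complex)
    show "connected (\<phi> ` E)" "connected (\<phi> ` F)" "compact (\<phi> ` F)"
      using assms lin(1) by (auto intro: connected_linear_image compact_continuous_image linear_continuous_on linear_conv_bounded_linear[THEN iffD1])
    show "\<phi> p \<in> \<phi> ` E" "\<phi> q \<in> \<phi> ` E" "\<phi> p \<noteq> \<phi> q" "\<phi> f \<in> \<phi> ` F" "\<phi> g \<in> \<phi> ` F" "\<phi> f \<noteq> \<phi> g"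
      using pts inj by (auto dest: injD)
    show "\<not> (\<exists>a b. a \<noteq> b \<and> \<phi> ` F = closed_segment a b)"
    proof (rule notI, elim exE conjE)
      fix a b assume ab: "a \<noteq> b" "\<phi> ` F = closed_segment a b"
      then have "F = closed_segment (\<psi> a) (\<psi> b)"
        by (metis closed_segment_linear_image image lin(2))
      moreover have "\<psi> a \<noteq> \<psi> b"
        using ab(1) \<phi>\<psi> by metis
      ultimately show False
        using assms(6) by blast
    qed
  qed
  moreover have "\<psi> ` (\<phi> ` E + \<phi> ` F) = E + F"
    by (force simp: set_plus_def linear_add[OF lin(2)] \<psi>\<phi>)
  moreover have "\<psi> ` interior (\<phi> ` E + \<phi> ` F) \<subseteq> interior (\<psi> ` (\<phi> ` E + \<phi> ` F))"
  proof (intro interior_maximal image_mono interior_subset)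
    show "open (\<psi> ` interior (\<phi> ` E + \<phi> ` F))"
      using lin(2) surjI[of \<psi> \<phi>, OF \<psi>\<phi>] by (intro open_surjective_linear_image) auto
  qed
  ultimately show ?thesis by auto
qed

end
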